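(* Let $G$ be a graph of order $n$. Then $\gamma(G)\le \dfrac{DI(G)}{n}\le \Gamma(G)$.
   Context: Graphs are finite, simple and undirected, with nonempty vertex set; the order is the number of vertices. A dominating set of a graph $G$ is a set $D\subseteq V(G)$ such that every vertex in $V(G)\setminus D$ is adjacent to some vertex of $D$. A minimal dominating set is a dominating set that does not properly contain any other dominating set. The domination number $\gamma(G)$ is the minimum cardinality of a dominating set of $G$; the upper domination number $\Gamma(G)$ is the maximum cardinality of a minimal dominating set of $G$. The domination degree of a vertex $a$ is $d_d(a)=\min\{|D| : D \text{ is a minimal dominating set of } G \text{ with } a\in D\}$. The domination index of $G$ is $DI(G)=\sum_{a\in V(G)}d_d(a)$. *)

theory Defs
  imports Complex_Main "Graph_Theory.Digraph"
begin

text \<open>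
  A finite simple undirected graph is a symmetric loop-free digraph without parallel arcs
  (the locale \<^locale>\<open>graph\<close>). That locale admits the null graph, so nonemptiness of the vertex
  set has to be assumed separately.
\<close>

definition dominating_set :: "('a, 'b) pre_digraph \<Rightarrow> 'a set \<Rightarrow> bool" where
  "dominating_set G D \<longleftrightarrow>
     D \<subseteq> verts G \<and> (\<forall>v \<in> verts G - D. \<exists>u \<in> D. v \<rightarrow>\<^bsub>G\<^esub> u)"

definition minimal_dominating_set :: "('a, 'b) pre_digraph \<Rightarrow> 'a set \<Rightarrow> bool" where
  "minimal_dominating_set G D \<longleftrightarrow>
     dominating_set G D \<and> \<not> (\<exists>D'. dominating_set G D' \<and> D' \<subset> D)"

text \<open>
  The minima and maxima below range over finite nonempty sets when \<^term>\<open>graph G\<close> holds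
  and, for the domination degree, \<^term>\<open>a \<in> verts G\<close>: there, nonemptiness holds because a maximal
  independent set containing \<^term>\<open>a\<close> is a minimal dominating set.
\<close>

definition domination_number :: "('a, 'b) pre_digraph \<Rightarrow> nat" where
  "domination_number G = Min {card D | D. dominating_set G D}"

definition upper_domination_number :: "('a, 'b) pre_digraph \<Rightarrow> nat" where
  "upper_domination_number G = Max {card D | D. minimal_dominating_set G D}"

definition domination_degree :: "('a, 'b) pre_digraph \<Rightarrow> 'a \<Rightarrow> nat" where
  "domination_degree G a = Min {card D | D. minimal_dominating_set G D \<and> a \<in> D}"

definition domination_index :: "('a, 'b) pre_digraph \<Rightarrow> nat" where
  "domination_index G = (\<Sum>a \<in> verts G. domination_degree G a)"

end

theory Submission
  imports Defs
begin

text \<open>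
  \<open>DI(G)/n\<close> is the average of the domination degrees, so it suffices to bound every single
  degree between \<open>\<gamma>(G)\<close> and \<open>\<Gamma>(G)\<close>. The degree of \<open>a\<close> is the size of an actual minimal
  dominating set through \<open>a\<close>; being dominating, it has at least \<open>\<gamma>(G)\<close> vertices, and being
  minimal, at most \<open>\<Gamma>(G)\<close>. The one point with graph-theoretic content is that such a set
  exists for every \<open>a\<close>: extend \<open>{a}\<close> to a maximal independent set. Maximality makes it
  dominating, and independence makes it minimal, because a vertex removed from it has no
  neighbour among those that remain.
\<close>

definition independent_set :: "('a, 'b) pre_digraph \<Rightarrow> 'a set \<Rightarrow> bool" where
  "independent_set G S \<longleftrightarrow> S \<subseteq> verts G \<and> (\<forall>u \<in> S. \<forall>v \<in> S. \<not> u \<rightarrow>\<^bsub>G\<^esub> v)"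

lemma (in fin_digraph) finite_Collect_subset_verts:
  assumes "\<And>D. P D \<Longrightarrow> D \<subseteq> verts G"
  shows "finite {D. P D}"
  using assms by (intro finite_subset[of "{D. P D}" "Pow (verts G)"]) auto

text \<open>
  If a proper subset \<open>D'\<close> were dominating, a vertex of \<open>D - D'\<close> would have a neighbour in \<open>D'\<close>,
  against independence.
\<close>

lemma independent_dominating_set_minimal:
  assumes "independent_set G D" and "dominating_set G D"
  shows "minimal_dominating_set G D"
proof -
  have False if D': "dominating_set G D'" "D' \<subset> D" for D'
  proof -
    from D'(2) obtain v where "v \<in> D" "v \<notin> D'" by blast
    moreover from this assms(1) have "v \<in> verts G"
      by (auto simp: independent_set_def)
    ultimately obtain u where "u \<in> D'" "v \<rightarrow>\<^bsub>G\<^esub> u"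
      using D'(1) unfolding dominating_set_def by blast
    with D'(2) \<open>v \<in> D\<close> assms(1) show False
      by (auto simp: independent_set_def)
  qed
  with assms(2) show ?thesis
    unfolding minimal_dominating_set_def by blast
qed

text \<open>
  A vertex outside \<open>S\<close> with no neighbour in \<open>S\<close> could be added to \<open>S\<close>. Symmetry turns the
  absence of arcs into \<open>S\<close> into the absence of arcs in both directions, and there are no loops.
\<close>

lemma (in graph) maximal_independent_set_dominating:
  assumes indep: "independent_set G S"
    and maximal: "\<And>T. independent_set G T \<Longrightarrow> S \<subseteq> T \<Longrightarrow> T = S"
  shows "dominating_set G S"
proof -
  have "\<exists>u \<in> S. v \<rightarrow>\<^bsub>G\<^esub> u" if v: "v \<in> verts G" "v \<notin> S" for v
  proof (rule ccontr)
    assume no_out: "\<not> (\<exists>u \<in> S. v \<rightarrow>\<^bsub>G\<^esub> u)"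
    then have no_in: "\<not> (\<exists>u \<in> S. u \<rightarrow>\<^bsub>G\<^esub> v)"
      using arcs_ends_symmetric[OF sym_arcs] by blast
    have "\<not> v \<rightarrow>\<^bsub>G\<^esub> v"
      using adj_not_same by blast
    with indep v no_out no_in have "independent_set G (insert v S)"
      unfolding independent_set_def by blast
    with maximal v(2) show False by blast
  qed
  with indep show ?thesis
    unfolding dominating_set_def independent_set_def by blast
qed

lemma (in graph) minimal_dominating_set_through:
  assumes "a \<in> verts G"
  obtains D where "minimal_dominating_set G D" "a \<in> D"
proof -
  have fin: "finite {S. independent_set G S}"
    by (rule finite_Collect_subset_verts) (simp add: independent_set_def)
  have "independent_set G {a}"
    using assms adj_not_same by (auto simp: independent_set_def)
  with finite_has_maximal2[OF fin, of "{a}"] obtain S where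
    S: "independent_set G S" "{a} \<subseteq> S" "\<And>T. independent_set G T \<Longrightarrow> S \<subseteq> T \<Longrightarrow> T = S"
    by auto
  from S(1,3) have "dominating_set G S"
    by (rule maximal_independent_set_dominating)
  with S(1) have "minimal_dominating_set G S"
    by (rule independent_dominating_set_minimal)
  with S(2) that show thesis by simp
qed

lemma (in fin_digraph) finite_card_dominating_sets:
  assumes "\<And>D. P D \<Longrightarrow> dominating_set G D"
  shows "finite {card D | D. P D}"
proof -
  have "finite {D. P D}"
    using assms by (intro finite_Collect_subset_verts) (simp add: dominating_set_def)
  then show ?thesis by simp
qed

text \<open>
  The minimum defining the degree ranges over a set that is nonempty by the preceding existence
  result, so some minimal dominating set realises it; both bounds on the degree are read off from
  this set.
\<close>

lemma (in graph) domination_degree_attained: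
  assumes "a \<in> verts G"
  obtains D where "minimal_dominating_set G D" "domination_degree G a = card D"
proof -
  let ?C = "{card D | D. minimal_dominating_set G D \<and> a \<in> D}"
  have "finite ?C"
    by (rule finite_card_dominating_sets) (simp add: minimal_dominating_set_def)
  moreover have "?C \<noteq> {}"
    using minimal_dominating_set_through[OF assms] by blast
  ultimately have "domination_degree G a \<in> ?C"
    unfolding domination_degree_def by (rule Min_in)
  with that show thesis by blast
qed

lemma (in graph) domination_number_le_degree:
  assumes "a \<in> verts G"
  shows "domination_number G \<le> domination_degree G a"
proof -
  obtain D where D: "minimal_dominating_set G D" "domination_degree G a = card D"
    using domination_degree_attained[OF assms] .
  have "finite {card D | D. dominating_set G D}"
    by (rule finite_card_dominating_sets)
  with D show ?thesis
    unfolding domination_number_def by (auto simp: minimal_dominating_set_def intro: Min_le)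
qed

lemma (in graph) domination_degree_le_upper:
  assumes "a \<in> verts G"
  shows "domination_degree G a \<le> upper_domination_number G"
proof -
  obtain D where D: "minimal_dominating_set G D" "domination_degree G a = card D"
    using domination_degree_attained[OF assms] .
  have "finite {card D | D. minimal_dominating_set G D}"
    by (rule finite_card_dominating_sets) (simp add: minimal_dominating_set_def)
  with D show ?thesis
    unfolding upper_domination_number_def by (auto intro: Max_ge)
qed

theorem proposition4p3:
  fixes G :: "('a, 'b) pre_digraph" and n :: nat
  assumes "graph G"
    and "verts G \<noteq> {}"
    and "n = card (verts G)"
  shows "real (domination_number G) \<le> real (domination_index G) / real n
    \<and> real (domination_index G) / real n \<le> real (upper_domination_number G)"
proof -
  interpret graph G by fact
  have "n > 0"
    using assms(2,3) by (simp add: card_gt_0_iff)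
  have "n * domination_number G \<le> domination_index G"
    unfolding domination_index_def assms(3)
    using sum_bounded_below[of "verts G" "domination_number G" "domination_degree G"]
    by (simp add: domination_number_le_degree)
  moreover have "domination_index G \<le> n * upper_domination_number G"
    unfolding domination_index_def assms(3)
    using sum_bounded_above[of "verts G" "domination_degree G" "upper_domination_number G"]
    by (simp add: domination_degree_le_upper)
  ultimately have "real n * real (domination_number G) \<le> real (domination_index G)"
    and "real (domination_index G) \<le> real n * real (upper_domination_number G)"
    by (metis of_nat_le_iff of_nat_mult)+
  with \<open>n > 0\<close> show ?thesis
    by (simp add: field_simps)
qed

end
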